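(* If the boundary conditions are periodic or the solution has compact support, then the two-dimensional PPCT (positivity-preserving constrained transport) scheme for solving the ideal MHD system, described in the context, preserves total energy conservation: $$\sum_{i,j}\left(E_{ij}^n+\frac12|\bm B_{ij}^n|^2\right)=\sum_{i,j}\left(E_{ij}^{n+1}+\frac12|\bm B_{ij}^{n+1}|^2\right).$$
   Context: Uniform 2D rectangular mesh with cells indexed by $(i,j)$, spacings $\Delta x,\Delta y>0$, time step $\Delta t>0$, ratio of specific heats $\gamma$, small $\epsilon>0$, fixed $q>2$. Cell averages and cell-center values are not distinguished. Unknowns per cell: $\bm Q_{ij}=(\rho_{ij},\bm m_{ij},E_{ij})^\top$ (density, momentum in $\mathbb R^3$, and mechanical energy $E$ = internal plus kinetic energy) and the magnetic field $\bm B_{ij}\in\mathbb R^3$. Velocity $\bm v=\bm m/\rho\in\mathbb R^3$, pressure $p=(\gamma-1)\left(E-\frac{|\bm m|^2}{2\rho}\right)$. Sums run over all cells. One PPCT step from time level $n$ to $n+1$ consists of: (Step 1) $(\rho^n,\bm m^n,E^n)\to(\rho^{(1)},\bm m^{(1)},E^{(1)})$ by the finite volume operator with time step $\tau=\Delta t/2$, $\bm B^n$ unchanged; (Step 2) $(\bm m^{(1)},\bm B^n,E^{(1)})\to(\bm m^{(2)},\bm B^{n+1},E^{(2)})$ by the CT operator with time step $\Delta t$, $\rho^{(1)}$ unchanged; (Step 3) $(\rho^{(1)},\bm m^{(2)},E^{(2)})\to(\rho^{n+1},\bm m^{n+1},E^{n+1})$ by the finite volume operator with time step $\tau=\Delta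 t/2$, $\bm B^{n+1}$ unchanged. Finite volume operator with time step $\tau$: $\bm Q^*=\bm Q+\tau\widetilde{\mathcal L}(\bm Q)$, $\bm Q^{\rm new}=\frac12\bm Q+\frac12\left(\bm Q^*+\tau\widetilde{\mathcal L}(\bm Q^* )\right)$, where $$\widetilde{\mathcal L}_{ij}(\bm Q)=-\tfrac1{\Delta x}\left(\hat{\bm G}_1(\widetilde{\bm Q}^-_{i+\frac12,j},\widetilde{\bm Q}^+_{i+\frac12,j})-\hat{\bm G}_1(\widetilde{\bm Q}^-_{i-\frac12,j},\widetilde{\bm Q}^+_{i-\frac12,j})\right)-\tfrac1{\Delta y}\left(\hat{\bm G}_2(\widetilde{\bm Q}^-_{i,j+\frac12},\widetilde{\bm Q}^+_{i,j+\frac12})-\hat{\bm G}_2(\widetilde{\bm Q}^-_{i,j-\frac12},\widetilde{\bm Q}^+_{i,j-\frac12})\right),$$ $\hat{\bm G}_\ell(\bm Q^-,\bm Q^+)=\frac12(\bm G_\ell(\bm Q^-)+\bm G_\ell(\bm Q^+)-\alpha_\ell(\bm Q^+-\bm Q^-))$ is the Lax–Friedrichs flux, $\bm G_\ell(\bm Q)=(m_\ell,\ m_\ell\bm v+p\,\mathbf e_\ell,\ (E+p)v_\ell)^\top$ with $\mathbf e_\ell$ the $\ell$-th unit vector of $\mathbb R^3$, $\alpha_\ell=\left\||v_\ell|+\sqrt{\gamma p/\rho}\right\|_{L^\infty}$, $\ell=1,2$. The interface states are obtained from the primitive variables $\overline{\bm W}_{ij}=(\overline\rho_{ij},\overline{\bm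 v}_{ij},\overline p_{ij})$ of $\bm Q_{ij}$ (given $\overline\rho_{ij}>0$, $\overline p_{ij}>0$) as follows. Componentwise van Albada slopes: with $a=(\overline W_{ij}-\overline W_{i-1,j})/\Delta x$, $b=(\overline W_{i+1,j}-\overline W_{ij})/\Delta x$, $\epsilon_x=3\Delta x$, $\delta W_{ij}^x=\frac{(b^2+\epsilon_x)a+(a^2+\epsilon_x)b}{a^2+b^2+2\epsilon_x}$, and analogously $\delta W_{ij}^y$ with $\epsilon_y=3\Delta y$; increments $(\Delta\rho^x,\Delta\bm v^x,\Delta p^x)_{ij}=\frac{\Delta x}2\delta\bm W_{ij}^x$, $(\Delta\rho^y,\Delta\bm v^y,\Delta p^y)_{ij}=\frac{\Delta y}2\delta\bm W_{ij}^y$. With $C_x=\frac{\alpha_1\Delta y}{\alpha_1\Delta y+\alpha_2\Delta x}$, $C_y=\frac{\alpha_2\Delta x}{\alpha_1\Delta y+\alpha_2\Delta x}$, for $\star\in\{x,y\}$: $\alpha^\star=\min\left(\frac{\overline\rho_{ij}}{|\Delta\rho_{ij}^\star|(1+\epsilon)},1\right)$ (or $1$ if $\Delta\rho_{ij}^\star=0$), $\kappa^\star=\min\left(\frac{\overline p_{ij}}{|\Delta p_{ij}^\star|(1+\epsilon)},1\right)$ (or $1$ if $\Delta p_{ij}^\star=0$), and $$\beta=\min\left(\sqrt{\frac{(q-2)^2\overline\rho_{ij}\overline p_{ij}}{(\gamma-1)\left(2|C_x\alpha^x\Delta\rho_{ij}^x\Delta\bm v_{ij}^x+C_y\alpha^y\Delta\rho_{ij}^y\Delta\bm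 v_{ij}^y|^2+(q-2)\overline\rho_{ij}^2(C_x|\Delta\bm v_{ij}^x|^2+C_y|\Delta\bm v_{ij}^y|^2)\right)}},1\right)$$ (or $1$ if $\Delta\bm v_{ij}^x=\Delta\bm v_{ij}^y=0$). Then $\widetilde{\bm Q}^{\mp}_{i\pm\frac12,j}$ has primitive variables $(\overline\rho_{ij}\pm\alpha^x\Delta\rho_{ij}^x,\overline{\bm v}_{ij}\pm\beta\Delta\bm v_{ij}^x,\overline p_{ij}\pm\kappa^x\Delta p_{ij}^x)$ and $\widetilde{\bm Q}^{\mp}_{i,j\pm\frac12}$ has primitive variables $(\overline\rho_{ij}\pm\alpha^y\Delta\rho_{ij}^y,\overline{\bm v}_{ij}\pm\beta\Delta\bm v_{ij}^y,\overline p_{ij}\pm\kappa^y\Delta p_{ij}^y)$. CT operator with time step $\Delta t$ (old values without prime, new values with prime, $\rho'=\rho$): with $\hat{\bm B}=\frac12(\bm B+\bm B')$, $\hat{\bm v}=\frac12(\bm v+\bm v')$, $\mathbf\Omega=(\Omega^x,\Omega^y,\Omega^z)^\top=\hat{\bm B}\times\hat{\bm v}$, $D_xf_{ij}=\frac{f_{i+1,j}-f_{i-1,j}}{2\Delta x}$, $D_yf_{ij}=\frac{f_{i,j+1}-f_{i,j-1}}{2\Delta y}$, the new values solve at every cell the implicit system $B'^x=B^x-\Delta t\,D_y\Omega^z$, $B'^y=B^y+\Delta t\,D_x\Omega^z$, $B'^z=B^z-\Delta t\,D_x\Omega^y+\Delta t\,D_y\Omega^x$, $\rho\bm v'=\rho\bm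 v-\Delta t\,\hat{\bm B}\times\operatorname{curl}\hat{\bm B}$ with $\operatorname{curl}\bm B=(D_yB^z,-D_xB^z,D_xB^y-D_yB^x)^\top$; then $\bm m'=\rho\bm v'$ and $E'=E-\frac12\rho|\bm v|^2+\frac12\rho|\bm v'|^2$. *)

theory Defs
  imports "HOL-Analysis.Analysis"
begin

text \<open>
  Grid functions live on the unbounded index set \<^typ>\<open>int \<times> int\<close> (curried); the actual mesh is a
  window of it, and the boundary conditions say how the data continue outside that window.
  A triple in \<^typ>\<open>real \<times> (real^3) \<times> real\<close> is used both for conserved variables (density, momentum,
  mechanical energy) and for primitive variables (density, velocity, pressure); sums and
  real multiples of conserved states are those of the product vector space.
\<close>

type_synonym vec3 = "real ^ 3"
type_synonym state = "real \<times> vec3 \<times> real"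
type_synonym 'a grid = "int \<Rightarrow> int \<Rightarrow> 'a"

definition dens :: "state \<Rightarrow> real" where "dens Q = fst Q"
definition mom :: "state \<Rightarrow> vec3" where "mom Q = fst (snd Q)"
definition ener :: "state \<Rightarrow> real" where "ener Q = snd (snd Q)"

definition velocity :: "state \<Rightarrow> vec3" where
  "velocity Q = mom Q /\<^sub>R dens Q"

definition van_albada :: "real \<Rightarrow> real \<Rightarrow> real \<Rightarrow> real" where
  "van_albada e a b = ((b\<^sup>2 + e) * a + (a\<^sup>2 + e) * b) / (a\<^sup>2 + b\<^sup>2 + 2 * e)"

text \<open>Half the mesh size \<open>h\<close> times the limited slope, from the left, middle and right cell values.\<close>

definition increment :: "real \<Rightarrow> real \<Rightarrow> real \<Rightarrow> real \<Rightarrow> real" where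
  "increment h wl w wr = h / 2 * van_albada (3 * h) ((w - wl) / h) ((wr - w) / h)"

definition increments :: "real \<Rightarrow> state \<Rightarrow> state \<Rightarrow> state \<Rightarrow> state" where
  "increments h = (\<lambda>(rl, vl, pl) (r, v, p) (rr, vr, pr).
     (increment h rl r rr, (\<chi> k. increment h (vl $ k) (v $ k) (vr $ k)), increment h pl p pr))"

locale ppct =
  fixes \<Delta>x \<Delta>y \<Delta>t \<gamma> \<epsilon> q :: real
  assumes mesh_size: "\<Delta>x > 0" "\<Delta>y > 0"
    and time_step: "\<Delta>t > 0"
    and heat_ratio: "\<gamma> > 1"
    and eps_pos: "\<epsilon> > 0"
    and q_gt_2: "q > 2"
begin

subsection \<open>Finite volume operator\<close>

definition pressure :: "state \<Rightarrow> real" where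
  "pressure Q = (\<gamma> - 1) * (ener Q - (norm (mom Q))\<^sup>2 / (2 * dens Q))"

definition to_prim :: "state \<Rightarrow> state" where
  "to_prim Q = (dens Q, velocity Q, pressure Q)"

definition from_prim :: "real \<Rightarrow> vec3 \<Rightarrow> real \<Rightarrow> state" where
  "from_prim r v p = (r, r *\<^sub>R v, p / (\<gamma> - 1) + r * (norm v)\<^sup>2 / 2)"

definition flux :: "3 \<Rightarrow> state \<Rightarrow> state" where
  "flux l Q = (mom Q $ l, (mom Q $ l) *\<^sub>R velocity Q + pressure Q *\<^sub>R axis l 1,
     (ener Q + pressure Q) * velocity Q $ l)"

text \<open>
  The maximum norm is over the cell values of the grid function to which the spatial operator is
  applied; under either boundary condition below it is a supremum over a finite set of values.
\<close>

definition wave_speed :: "3 \<Rightarrow> state grid \<Rightarrow> real" where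
  "wave_speed l Q =
     (SUP (i, j). \<bar>velocity (Q i j) $ l\<bar> + sqrt (\<gamma> * pressure (Q i j) / dens (Q i j)))"

definition lf_flux :: "3 \<Rightarrow> real \<Rightarrow> state \<Rightarrow> state \<Rightarrow> state" where
  "lf_flux l a Qm Qp = (1/2) *\<^sub>R (flux l Qm + flux l Qp - a *\<^sub>R (Qp - Qm))"

definition incr_x :: "state grid \<Rightarrow> state grid" where
  "incr_x Q i j =
     increments \<Delta>x (to_prim (Q (i - 1) j)) (to_prim (Q i j)) (to_prim (Q (i + 1) j))"

definition incr_y :: "state grid \<Rightarrow> state grid" where
  "incr_y Q i j =
     increments \<Delta>y (to_prim (Q i (j - 1))) (to_prim (Q i j)) (to_prim (Q i (j + 1)))"

definition limiter :: "real \<Rightarrow> real \<Rightarrow> real" where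
  "limiter w d = (if d = 0 then 1 else min (w / (\<bar>d\<bar> * (1 + \<epsilon>))) 1)"

definition vel_limiter :: "state grid \<Rightarrow> real grid" where
  "vel_limiter Q i j =
     (let (\<rho>, v, p) = to_prim (Q i j);
          (dr\<^sub>x, dv\<^sub>x, dp\<^sub>x) = incr_x Q i j;
          (dr\<^sub>y, dv\<^sub>y, dp\<^sub>y) = incr_y Q i j;
          a\<^sub>1 = wave_speed 1 Q;
          a\<^sub>2 = wave_speed 2 Q;
          C\<^sub>x = a\<^sub>1 * \<Delta>y / (a\<^sub>1 * \<Delta>y + a\<^sub>2 * \<Delta>x);
          C\<^sub>y = a\<^sub>2 * \<Delta>x / (a\<^sub>1 * \<Delta>y + a\<^sub>2 * \<Delta>x)
      in if dv\<^sub>x = 0 \<and> dv\<^sub>y = 0 then 1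
         else min (sqrt ((q - 2)\<^sup>2 * \<rho> * p /
                ((\<gamma> - 1) *
                 (2 * (norm ((C\<^sub>x * limiter \<rho> dr\<^sub>x * dr\<^sub>x) *\<^sub>R dv\<^sub>x + (C\<^sub>y * limiter \<rho> dr\<^sub>y * dr\<^sub>y) *\<^sub>R dv\<^sub>y))\<^sup>2
                  + (q - 2) * \<rho>\<^sup>2 * (C\<^sub>x * (norm dv\<^sub>x)\<^sup>2 + C\<^sub>y * (norm dv\<^sub>y)\<^sup>2))))) 1)"

text \<open>
  The interface states reconstructed inside cell \<open>(i, j)\<close>: sign \<open>s = 1\<close> gives the value at the
  right (top) edge, \<open>s = -1\<close> the one at the left (bottom) edge.
\<close>

definition limited_state :: "state \<Rightarrow> state \<Rightarrow> real \<Rightarrow> real \<Rightarrow> state" where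
  "limited_state W dW \<beta> s =
     (let (\<rho>, v, p) = W; (dr, dv, dp) = dW
      in from_prim (\<rho> + s * (limiter \<rho> dr * dr)) (v + (s * \<beta>) *\<^sub>R dv) (p + s * (limiter p dp * dp)))"

definition edge_x :: "real \<Rightarrow> state grid \<Rightarrow> state grid" where
  "edge_x s Q i j = limited_state (to_prim (Q i j)) (incr_x Q i j) (vel_limiter Q i j) s"

definition edge_y :: "real \<Rightarrow> state grid \<Rightarrow> state grid" where
  "edge_y s Q i j = limited_state (to_prim (Q i j)) (incr_y Q i j) (vel_limiter Q i j) s"

text \<open>Numerical fluxes at the interfaces \<open>(i + 1/2, j)\<close> and \<open>(i, j + 1/2)\<close>.\<close>

definition num_flux_x :: "state grid \<Rightarrow> state grid" where
  "num_flux_x Q i j = lf_flux 1 (wave_speed 1 Q) (edge_x 1 Q i j) (edge_x (-1) Q (i + 1) j)"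

definition num_flux_y :: "state grid \<Rightarrow> state grid" where
  "num_flux_y Q i j = lf_flux 2 (wave_speed 2 Q) (edge_y 1 Q i j) (edge_y (-1) Q i (j + 1))"

definition fv_rhs :: "state grid \<Rightarrow> state grid" where
  "fv_rhs Q i j =
     - ((1 / \<Delta>x) *\<^sub>R (num_flux_x Q i j - num_flux_x Q (i - 1) j))
     - (1 / \<Delta>y) *\<^sub>R (num_flux_y Q i j - num_flux_y Q i (j - 1))"

definition fv_euler :: "real \<Rightarrow> state grid \<Rightarrow> state grid" where
  "fv_euler \<tau> Q i j = Q i j + \<tau> *\<^sub>R fv_rhs Q i j"

text \<open>
  The reconstruction requires positive density and pressure.  The vacuum state \<^term>\<open>0 :: state\<close> is
  admitted in addition, so that a solution may have compact support in the literal sense; by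
  the convention \<open>x / 0 = 0\<close> its velocity, pressure, sound speed and reconstructed states vanish.
\<close>

definition admissible :: "state grid \<Rightarrow> bool" where
  "admissible Q \<longleftrightarrow> (\<forall>i j. Q i j = 0 \<or> dens (Q i j) > 0 \<and> pressure (Q i j) > 0)"

definition fv_step :: "real \<Rightarrow> state grid \<Rightarrow> state grid \<Rightarrow> bool" where
  "fv_step \<tau> Q Q' \<longleftrightarrow> admissible Q \<and> admissible (fv_euler \<tau> Q) \<and>
     (\<forall>i j. Q' i j = (1/2) *\<^sub>R Q i j + (1/2) *\<^sub>R fv_euler \<tau> (fv_euler \<tau> Q) i j)"

subsection \<open>Constrained transport operator\<close>

definition Dx :: "real grid \<Rightarrow> real grid" where
  "Dx f i j = (f (i + 1) j - f (i - 1) j) / (2 * \<Delta>x)"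

definition Dy :: "real grid \<Rightarrow> real grid" where
  "Dy f i j = (f i (j + 1) - f i (j - 1)) / (2 * \<Delta>y)"

definition comp :: "3 \<Rightarrow> vec3 grid \<Rightarrow> real grid" where
  "comp k F i j = F i j $ k"

definition curl :: "vec3 grid \<Rightarrow> vec3 grid" where
  "curl F i j = vector [Dy (comp 3 F) i j, - Dx (comp 3 F) i j,
     Dx (comp 2 F) i j - Dy (comp 1 F) i j]"

text \<open>A relation rather than a function, since the new values are defined by an implicit system.\<close>

definition ct_step :: "state grid \<Rightarrow> vec3 grid \<Rightarrow> state grid \<Rightarrow> vec3 grid \<Rightarrow> bool" where
  "ct_step Q B Q' B' \<longleftrightarrow>
     (let v = (\<lambda>i j. velocity (Q i j));
          v' = (\<lambda>i j. velocity (Q' i j));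
          Bh = (\<lambda>i j. (1/2) *\<^sub>R (B i j + B' i j));
          vh = (\<lambda>i j. (1/2) *\<^sub>R (v i j + v' i j));
          \<Omega> = (\<lambda>i j. cross3 (Bh i j) (vh i j))
      in \<forall>i j. let \<rho> = dens (Q i j) in
           B' i j $ 1 = B i j $ 1 - \<Delta>t * Dy (comp 3 \<Omega>) i j \<and>
           B' i j $ 2 = B i j $ 2 + \<Delta>t * Dx (comp 3 \<Omega>) i j \<and>
           B' i j $ 3 = B i j $ 3 - \<Delta>t * Dx (comp 2 \<Omega>) i j + \<Delta>t * Dy (comp 1 \<Omega>) i j \<and>
           \<rho> *\<^sub>R v' i j = \<rho> *\<^sub>R v i j - \<Delta>t *\<^sub>R cross3 (Bh i j) (curl Bh i j) \<and>
           dens (Q' i j) = \<rho> \<and>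
           mom (Q' i j) = \<rho> *\<^sub>R v' i j \<and>
           ener (Q' i j) = ener (Q i j) - \<rho> * (norm (v i j))\<^sup>2 / 2 + \<rho> * (norm (v' i j))\<^sup>2 / 2)"

definition ppct_step :: "state grid \<Rightarrow> vec3 grid \<Rightarrow> state grid \<Rightarrow> vec3 grid \<Rightarrow> bool" where
  "ppct_step Q B Q' B' \<longleftrightarrow>
     (\<exists>Q\<^sub>1 Q\<^sub>2. fv_step (\<Delta>t / 2) Q Q\<^sub>1 \<and> ct_step Q\<^sub>1 B Q\<^sub>2 B' \<and> fv_step (\<Delta>t / 2) Q\<^sub>2 Q')"

end

subsection \<open>Boundary conditions for a mesh of \<open>Nx \<times> Ny\<close> cells\<close>

definition periodic :: "int \<Rightarrow> int \<Rightarrow> 'a grid \<Rightarrow> bool" where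
  "periodic Nx Ny f \<longleftrightarrow> (\<forall>i j. f (i + Nx) j = f i j \<and> f i (j + Ny) = f i j)"

text \<open>
  The mesh contains the support of the solution: outside it there is no magnetic field and the
  fluid is in a fixed uniform state at rest, common to both time levels.  For \<open>Q\<^sub>0 = 0\<close> this is compact
  support of all unknowns; a nonzero \<open>Q\<^sub>0\<close> is the usual meaning for strictly positive density and
  pressure.
\<close>

definition supported_in ::
  "int \<Rightarrow> int \<Rightarrow> state grid \<Rightarrow> vec3 grid \<Rightarrow> state grid \<Rightarrow> vec3 grid \<Rightarrow> bool" where
  "supported_in Nx Ny Q B Q' B' \<longleftrightarrow>
     (\<exists>Q\<^sub>0. mom Q\<^sub>0 = 0 \<and>
        (\<forall>i j. (i, j) \<notin> {1..Nx} \<times> {1..Ny} \<longrightarrow>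
           Q i j = Q\<^sub>0 \<and> Q' i j = Q\<^sub>0 \<and> B i j = 0 \<and> B' i j = 0))"

end

theory Submission
  imports Defs
begin

text \<open>
  The finite volume update is a difference of fluxes, and the local energy change in the
  constrained transport step is \<open>\<Delta>t (\<Omega> \<bullet> curl B - B \<bullet> curl \<Omega>)\<close> at the time midpoint, so both sum to
  boundary terms.  These cancel as soon as the data agree near opposite sides of the summation
  window.  For periodic data this holds on the mesh itself; for compact support it holds on a
  window larger than the mesh, which leaves room for the intermediate states to spread: each
  Euler stage widens their support by two cells.
\<close>

section \<open>Windows whose opposite sides carry matching data\<close>

text \<open>The index \<open>k\<close> runs over all integers, so a stencil that reaches past a
  corner of the window still meets matching values. The margin \<open>r\<close> counts the matching
  lines on either side of each seam line; every local operation consumes part of it.\<close>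

definition seam :: "int \<Rightarrow> int \<Rightarrow> int \<Rightarrow> int \<Rightarrow> int \<Rightarrow> 'a grid \<Rightarrow> bool" where
  "seam a b c d r f \<longleftrightarrow>
     (\<forall>s k. \<bar>s\<bar> \<le> r \<longrightarrow> f (a + s) k = f (b + s) k \<and> f k (c + s) = f k (d + s))"

lemma seamD:
  assumes "seam a b c d r f" "\<bar>s\<bar> \<le> r"
  shows "f (a + s) k = f (b + s) k" "f k (c + s) = f k (d + s)"
  using assms by (auto simp: seam_def)

lemma seam_mono: "seam a b c d r f \<Longrightarrow> r' \<le> r \<Longrightarrow> seam a b c d r' f"
  by (auto simp: seam_def)

lemma seam_map2:
  "seam a b c d r f \<Longrightarrow> seam a b c d r g \<Longrightarrow> seam a b c d r (\<lambda>i j. h (f i j) (g i j))"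
  by (auto simp: seam_def)

text \<open>The second assumption expresses that \<open>g\<close> arises from \<open>f\<close> by
  the same stencil of radius \<open>k\<close> in every cell. Offsets along a seam are harmless
  because \<open>seam\<close> holds in all rows and columns, so only offsets across it consume
  margin.\<close>

lemma seam_local:
  assumes "seam a b c d (r + k) f"
    and "\<And>i j i' j'. (\<And>s t. \<bar>s\<bar> \<le> k \<Longrightarrow> \<bar>t\<bar> \<le> k \<Longrightarrow> f (i + s) (j + t) = f (i' + s) (j' + t))
          \<Longrightarrow> g i j = g i' j'"
  shows "seam a b c d r g"
  unfolding seam_def
proof (intro allI impI conjI)
  fix s m :: int assume s: "\<bar>s\<bar> \<le> r"
  show "g (a + s) m = g (b + s) m"
  proof (rule assms(2))
    fix u v :: int assume "\<bar>u\<bar> \<le> k"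
    then show "f (a + s + u) (m + v) = f (b + s + u) (m + v)"
      using seamD(1)[OF assms(1), of "s + u" "m + v"] s by (simp add: add.assoc)
  qed
  show "g m (c + s) = g m (d + s)"
  proof (rule assms(2))
    fix u v :: int assume "\<bar>v\<bar> \<le> k"
    then show "f (m + u) (c + s + v) = f (m + u) (d + s + v)"
      using seamD(2)[OF assms(1), of "s + v" "m + u"] s by (simp add: add.assoc)
  qed
qed

lemma seam_periodic: "periodic Nx Ny f \<Longrightarrow> seam 0 Nx 0 Ny r f"
  by (auto simp: periodic_def seam_def add.commute)

text \<open>With these corners the compared columns are \<open>-2r..0\<close> and
  \<open>Nx+1..Nx+2r+1\<close>, which lie just outside the mesh; likewise for rows.\<close>

lemma seam_supported:
  assumes "\<And>i j. (i, j) \<notin> {1..Nx} \<times> {1..Ny} \<Longrightarrow> f i j = f\<^sub>0"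
  shows "seam (- r) (Nx + r + 1) (- r) (Ny + r + 1) r f"
proof -
  have "f (- r + s) k = f\<^sub>0" "f (Nx + r + 1 + s) k = f\<^sub>0"
       "f k (- r + s) = f\<^sub>0" "f k (Ny + r + 1 + s) = f\<^sub>0" if "\<bar>s\<bar> \<le> r" for s k
    using that by (auto intro!: assms)
  then show ?thesis by (simp only: seam_def) simp
qed

section \<open>Telescoping sums and change of window\<close>

text \<open>On the half-open interval the surviving terms sit at \<open>a\<close> and
  \<open>b\<close>, exactly the two lines that \<open>seam\<close> compares.\<close>

lemma sum_telescope_int:
  fixes f :: "int \<Rightarrow> 'a::ab_group_add"
  assumes "a \<le> b"
  shows "(\<Sum>i\<in>{a<..b}. f i - f (i - 1)) = f b - f a"
  using assms
proof (induction b rule: int_ge_induct)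
  case (step b)
  then have "{a<..b + 1} = insert (b + 1) {a<..b}" by auto
  then show ?case using step by simp
qed simp

lemma sum_box_telescope:
  fixes F G :: "'a::ab_group_add grid"
  assumes "a \<le> b" "c \<le> d" "\<And>j. F a j = F b j" "\<And>i. G i c = G i d"
  shows "(\<Sum>i\<in>{a<..b}. \<Sum>j\<in>{c<..d}. F i j - F (i - 1) j) = 0"
    and "(\<Sum>i\<in>{a<..b}. \<Sum>j\<in>{c<..d}. G i j - G i (j - 1)) = 0"
proof -
  have "(\<Sum>j\<in>{c<..d}. \<Sum>i\<in>{a<..b}. F i j - F (i - 1) j) = 0"
    using sum_telescope_int[OF assms(1), of "\<lambda>i. F i _"] assms(3) by simp
  then show "(\<Sum>i\<in>{a<..b}. \<Sum>j\<in>{c<..d}. F i j - F (i - 1) j) = 0"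
    by (subst sum.swap)
  show "(\<Sum>i\<in>{a<..b}. \<Sum>j\<in>{c<..d}. G i j - G i (j - 1)) = 0"
    using sum_telescope_int[OF assms(2), of "G _"] assms(4) by simp
qed

text \<open>Brings a balance on an enlarged window back to the mesh. Outside the mesh
  \<open>F\<close> and \<open>G\<close> agree but may be nonzero, since the ambient state can carry
  energy; hence the argument sums \<open>F - G\<close>.\<close>

lemma sum_box_eq_imp_subbox_eq:
  fixes F G :: "real grid"
  assumes "(\<Sum>i\<in>{a<..b}. \<Sum>j\<in>{c<..d}. F i j) = (\<Sum>i\<in>{a<..b}. \<Sum>j\<in>{c<..d}. G i j)"
    and "A \<times> B \<subseteq> {a<..b} \<times> {c<..d}"
    and "\<And>i j. (i, j) \<notin> A \<times> B \<Longrightarrow> F i j = G i j"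
  shows "(\<Sum>i\<in>A. \<Sum>j\<in>B. F i j) = (\<Sum>i\<in>A. \<Sum>j\<in>B. G i j)"
proof -
  have "(\<Sum>(i, j)\<in>A \<times> B. F i j - G i j) = (\<Sum>(i, j)\<in>{a<..b} \<times> {c<..d}. F i j - G i j)"
  proof (rule sum.mono_neutral_left)
    show "\<forall>p\<in>{a<..b} \<times> {c<..d} - A \<times> B. (case p of (i, j) \<Rightarrow> F i j - G i j) = 0"
      using assms(3) by (metis DiffD2 case_prod_conv diff_self surj_pair)
  qed (use assms(2) in auto)
  then have "(\<Sum>i\<in>A. \<Sum>j\<in>B. F i j - G i j) = (\<Sum>i\<in>{a<..b}. \<Sum>j\<in>{c<..d}. F i j - G i j)"
    by (simp add: sum.cartesian_product)
  then show ?thesis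
    using assms(1) by (simp add: sum_subtractf)
qed

section \<open>Finite volume operator: stencils and conservation\<close>

context ppct
begin

lemma incr_cong:
  assumes "\<And>s t. \<bar>s\<bar> \<le> 1 \<Longrightarrow> \<bar>t\<bar> \<le> 1 \<Longrightarrow> Q (i + s) (j + t) = Q (i' + s) (j' + t)"
  shows "Q i j = Q i' j'" "incr_x Q i j = incr_x Q i' j'" "incr_y Q i j = incr_y Q i' j'"
  using assms[of 0 0] assms[of 1 0] assms[of "-1" 0] assms[of 0 1] assms[of 0 "-1"]
  by (simp_all add: incr_x_def incr_y_def)

text \<open>The wave speeds inside \<open>vel_limiter\<close> depend on the whole grid, but both
  sides refer to the same \<open>Q\<close>, so they are the same numbers. All remaining data come
  from a five-point stencil.\<close>

lemma edge_cong:
  assumes "\<And>s t. \<bar>s\<bar> \<le> 1 \<Longrightarrow> \<bar>t\<bar> \<le> 1 \<Longrightarrow> Q (i + s) (j + t) = Q (i' + s) (j' + t)"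
  shows "edge_x \<sigma> Q i j = edge_x \<sigma> Q i' j'" "edge_y \<sigma> Q i j = edge_y \<sigma> Q i' j'"
  using incr_cong[of Q i j i' j', OF assms]
  by (simp_all add: edge_x_def edge_y_def vel_limiter_def)

text \<open>Radius 2 arises because an interface of cell \<open>(i, j)\<close> involves the
  reconstruction in an adjacent cell, which looks one cell further.\<close>

lemma num_flux_cong:
  assumes "\<And>s t. \<bar>s\<bar> \<le> 2 \<Longrightarrow> \<bar>t\<bar> \<le> 2 \<Longrightarrow> Q (i + s) (j + t) = Q (i' + s) (j' + t)"
  shows "num_flux_x Q i j = num_flux_x Q i' j'"
    and "num_flux_x Q (i - 1) j = num_flux_x Q (i' - 1) j'"
    and "num_flux_y Q i j = num_flux_y Q i' j'"
    and "num_flux_y Q i (j - 1) = num_flux_y Q i' (j' - 1)"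
proof -
  have e: "edge_x \<sigma> Q (i + s) (j + t) = edge_x \<sigma> Q (i' + s) (j' + t)"
       "edge_y \<sigma> Q (i + s) (j + t) = edge_y \<sigma> Q (i' + s) (j' + t)"
    if "\<bar>s\<bar> \<le> 1" "\<bar>t\<bar> \<le> 1" for \<sigma> s t
    using that assms by (auto intro!: edge_cong simp: add.assoc)
  show "num_flux_x Q i j = num_flux_x Q i' j'"
       "num_flux_x Q (i - 1) j = num_flux_x Q (i' - 1) j'"
       "num_flux_y Q i j = num_flux_y Q i' j'"
       "num_flux_y Q i (j - 1) = num_flux_y Q i' (j' - 1)"
    using e[of 0 0] e[of 1 0] e[of "-1" 0] e[of 0 1] e[of 0 "-1"]
    by (simp_all add: num_flux_x_def num_flux_y_def)
qed

lemma seam_num_flux: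
  assumes "seam a b c d (r + 2) Q"
  shows "seam a b c d r (num_flux_x Q)" "seam a b c d r (num_flux_y Q)"
  by (rule seam_local[OF assms], rule num_flux_cong, blast)+

lemma seam_fv_euler:
  assumes "seam a b c d (r + 2) Q"
  shows "seam a b c d r (fv_euler \<tau> Q)"
proof (rule seam_local[OF assms])
  fix i j i' j' :: int
  assume Q: "\<And>s t. \<bar>s\<bar> \<le> 2 \<Longrightarrow> \<bar>t\<bar> \<le> 2 \<Longrightarrow> Q (i + s) (j + t) = Q (i' + s) (j' + t)"
  have "Q i j = Q i' j'"
    using Q[of 0 0] by simp
  then show "fv_euler \<tau> Q i j = fv_euler \<tau> Q i' j'"
    by (simp add: fv_euler_def fv_rhs_def num_flux_cong[of Q i j i' j', OF Q])
qed

text \<open>The margin 4 pays for two nested Euler stages at 2 each.\<close>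

lemma seam_fv_step:
  assumes "fv_step \<tau> Q Q'" "seam a b c d (r + 4) Q"
  shows "seam a b c d r Q'"
proof -
  have "seam a b c d r (fv_euler \<tau> (fv_euler \<tau> Q))"
    using assms(2) by (intro seam_fv_euler) (simp add: add.assoc)
  moreover have "seam a b c d r Q"
    using assms(2) by (rule seam_mono) simp
  moreover have "Q' = (\<lambda>i j. (1/2) *\<^sub>R Q i j + (1/2) *\<^sub>R fv_euler \<tau> (fv_euler \<tau> Q) i j)"
    using assms(1) by (auto simp: fv_step_def)
  ultimately show ?thesis
    by (simp add: seam_def)
qed

text \<open>All conserved components are handled at once, as sums in the vector space of states.
  Margin 2 is what makes the fluxes through opposite sides of the window equal.\<close>

lemma fv_euler_conservative:
  assumes "a \<le> b" "c \<le> d" "seam a b c d 2 Q"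
  shows "(\<Sum>i\<in>{a<..b}. \<Sum>j\<in>{c<..d}. fv_euler \<tau> Q i j) = (\<Sum>i\<in>{a<..b}. \<Sum>j\<in>{c<..d}. Q i j)"
proof -
  have seams: "seam a b c d 0 (num_flux_x Q)" "seam a b c d 0 (num_flux_y Q)"
    using assms(3) by (auto intro!: seam_num_flux)
  have "num_flux_x Q a j = num_flux_x Q b j" "num_flux_y Q i c = num_flux_y Q i d" for i j
    using seamD(1)[OF seams(1), of 0] seamD(2)[OF seams(2), of 0] by simp_all
  note tel = sum_box_telescope[OF assms(1,2), of "num_flux_x Q" "num_flux_y Q", OF this]
  have "(\<Sum>i\<in>{a<..b}. \<Sum>j\<in>{c<..d}. fv_rhs Q i j) =
      - ((1 / \<Delta>x) *\<^sub>R (\<Sum>i\<in>{a<..b}. \<Sum>j\<in>{c<..d}. num_flux_x Q i j - num_flux_x Q (i - 1) j))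
      - (1 / \<Delta>y) *\<^sub>R (\<Sum>i\<in>{a<..b}. \<Sum>j\<in>{c<..d}. num_flux_y Q i j - num_flux_y Q i (j - 1))"
    unfolding fv_rhs_def by (simp only: sum_subtractf sum_negf scaleR_right.sum[symmetric])
  then have "(\<Sum>i\<in>{a<..b}. \<Sum>j\<in>{c<..d}. fv_rhs Q i j) = 0"
    unfolding tel by simp
  moreover have "(\<Sum>i\<in>{a<..b}. \<Sum>j\<in>{c<..d}. fv_euler \<tau> Q i j) =
      (\<Sum>i\<in>{a<..b}. \<Sum>j\<in>{c<..d}. Q i j) + \<tau> *\<^sub>R (\<Sum>i\<in>{a<..b}. \<Sum>j\<in>{c<..d}. fv_rhs Q i j)"
    by (simp only: fv_euler_def sum.distrib scaleR_right.sum)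
  ultimately show ?thesis by simp
qed

lemma fv_step_conservative:
  assumes "fv_step \<tau> Q Q'" "a \<le> b" "c \<le> d" "seam a b c d 4 Q"
  shows "(\<Sum>i\<in>{a<..b}. \<Sum>j\<in>{c<..d}. Q' i j) = (\<Sum>i\<in>{a<..b}. \<Sum>j\<in>{c<..d}. Q i j)"
proof -
  have "seam a b c d 2 (fv_euler \<tau> Q)" "seam a b c d 2 Q"
    using assms(4) by (auto intro: seam_fv_euler seam_mono)
  note cons = this[THEN fv_euler_conservative[OF assms(2,3), where \<tau> = \<tau>]]
  have "(\<Sum>i\<in>{a<..b}. \<Sum>j\<in>{c<..d}. Q' i j) =
      (1/2) *\<^sub>R (\<Sum>i\<in>{a<..b}. \<Sum>j\<in>{c<..d}. Q i j) +
      (1/2) *\<^sub>R (\<Sum>i\<in>{a<..b}. \<Sum>j\<in>{c<..d}. fv_euler \<tau> (fv_euler \<tau> Q) i j)"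
    using assms(1) by (simp add: fv_step_def sum.distrib scaleR_right.sum)
  then show ?thesis
    by (simp add: cons flip: scaleR_left_distrib)
qed

lemma fv_step_energy:
  assumes "fv_step \<tau> Q Q'" "a \<le> b" "c \<le> d" "seam a b c d 4 Q"
  shows "(\<Sum>i\<in>{a<..b}. \<Sum>j\<in>{c<..d}. ener (Q' i j)) = (\<Sum>i\<in>{a<..b}. \<Sum>j\<in>{c<..d}. ener (Q i j))"
  using arg_cong[OF fv_step_conservative[OF assms], of ener]
  by (simp add: ener_def snd_sum)

section \<open>Summation by parts for central differences and the curl\<close>

lemma sum_Dx_by_parts:
  assumes "a \<le> b" "c \<le> d" "seam a b c d 1 f" "seam a b c d 1 g"
  shows "(\<Sum>i\<in>{a<..b}. \<Sum>j\<in>{c<..d}. f i j * Dx g i j + g i j * Dx f i j) = 0"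
proof -
  \<comment> \<open>A discrete product rule: \<open>h i j\<close> acts as an interface flux for the
    product \<open>f g\<close> between cells \<open>i\<close> and \<open>i + 1\<close>. Its values
    at \<open>a\<close> and \<open>b\<close> involve the next column too, hence margin 1.\<close>
  define h where "h i j = (f (i + 1) j * g i j + g (i + 1) j * f i j) / (2 * \<Delta>x)" for i j
  have "h a j = h b j" for j
    using seamD(1)[OF assms(3), of 0] seamD(1)[OF assms(3), of 1]
      seamD(1)[OF assms(4), of 0] seamD(1)[OF assms(4), of 1]
    by (simp add: h_def)
  moreover have "f i j * Dx g i j + g i j * Dx f i j = h i j - h (i - 1) j" for i j
    using mesh_size by (simp add: Dx_def h_def field_simps)
  ultimately show ?thesis
    using sum_box_telescope(1)[OF assms(1,2), of h "\<lambda>_ _. 0"] by simp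
qed

lemma sum_Dy_by_parts:
  assumes "a \<le> b" "c \<le> d" "seam a b c d 1 f" "seam a b c d 1 g"
  shows "(\<Sum>i\<in>{a<..b}. \<Sum>j\<in>{c<..d}. f i j * Dy g i j + g i j * Dy f i j) = 0"
proof -
  define h where "h i j = (f i (j + 1) * g i j + g i (j + 1) * f i j) / (2 * \<Delta>y)" for i j
  have "h i c = h i d" for i
    using seamD(2)[OF assms(3), of 0] seamD(2)[OF assms(3), of 1]
      seamD(2)[OF assms(4), of 0] seamD(2)[OF assms(4), of 1]
    by (simp add: h_def)
  moreover have "f i j * Dy g i j + g i j * Dy f i j = h i j - h i (j - 1)" for i j
    using mesh_size by (simp add: Dy_def h_def field_simps)
  ultimately show ?thesis
    using sum_box_telescope(2)[OF assms(1,2), of "\<lambda>_ _. 0" h] by simp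
qed

text \<open>Discrete counterpart of F . curl G - G . curl F = div (G x F). Below,
  \<open>X k l\<close> and \<open>Y k l\<close> stand for the x- and y-derivatives of the product of
  the components \<open>F_k\<close> and \<open>G_l\<close>, so each sums to zero.\<close>

lemma curl_self_adjoint:
  assumes "a \<le> b" "c \<le> d" "seam a b c d 1 F" "seam a b c d 1 G"
  shows "(\<Sum>i\<in>{a<..b}. \<Sum>j\<in>{c<..d}. F i j \<bullet> curl G i j - G i j \<bullet> curl F i j) = 0"
proof -
  have "seam a b c d 1 (comp k F)" "seam a b c d 1 (comp k G)" for k
    using assms(3,4) by (auto simp: seam_def comp_def)
  note parts = sum_Dx_by_parts[OF assms(1,2) this] sum_Dy_by_parts[OF assms(1,2) this]
  define X where "X k l i j = comp k F i j * Dx (comp l G) i j + comp l G i j * Dx (comp k F) i j"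
    for k l i j
  define Y where "Y k l i j = comp k F i j * Dy (comp l G) i j + comp l G i j * Dy (comp k F) i j"
    for k l i j
  have "F i j \<bullet> curl G i j - G i j \<bullet> curl F i j = Y 1 3 i j - X 2 3 i j + X 3 2 i j - Y 3 1 i j"
    for i j
    by (simp add: X_def Y_def inner_vec_def sum_3 curl_def comp_def algebra_simps)
  then show ?thesis
    by (simp add: sum.distrib sum_subtractf parts[folded X_def Y_def])
qed

section \<open>Energy balance of the constrained transport step\<close>

definition midpoint_grid :: "vec3 grid \<Rightarrow> vec3 grid \<Rightarrow> vec3 grid" where
  "midpoint_grid F F' i j = (1/2) *\<^sub>R (F i j + F' i j)"

text \<open>This is the electric field of the ideal Ohm law, E = - v x B = B x v, at the time
  midpoint. Faraday's law then updates \<open>B\<close> by its curl.\<close>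

definition emf :: "state grid \<Rightarrow> vec3 grid \<Rightarrow> state grid \<Rightarrow> vec3 grid \<Rightarrow> vec3 grid" where
  "emf Q B Q' B' i j = cross3 (midpoint_grid B B' i j)
     (midpoint_grid (\<lambda>i j. velocity (Q i j)) (\<lambda>i j. velocity (Q' i j)) i j)"

lemma ct_stepD:
  assumes "ct_step Q B Q' B'"
  shows "B' i j = B i j - \<Delta>t *\<^sub>R curl (emf Q B Q' B') i j"
    and "dens (Q i j) *\<^sub>R velocity (Q' i j) = dens (Q i j) *\<^sub>R velocity (Q i j)
          - \<Delta>t *\<^sub>R cross3 (midpoint_grid B B' i j) (curl (midpoint_grid B B') i j)"
    and "dens (Q' i j) = dens (Q i j)"
    and "mom (Q' i j) = dens (Q i j) *\<^sub>R velocity (Q' i j)"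
    and "ener (Q' i j) = ener (Q i j) - dens (Q i j) * (norm (velocity (Q i j)))\<^sup>2 / 2
          + dens (Q i j) * (norm (velocity (Q' i j)))\<^sup>2 / 2"
proof -
  have emf: "emf Q B Q' B' = (\<lambda>i j. cross3 ((1/2) *\<^sub>R (B i j + B' i j))
      ((1/2) *\<^sub>R (velocity (Q i j) + velocity (Q' i j))))"
    and mid: "midpoint_grid B B' = (\<lambda>i j. (1/2) *\<^sub>R (B i j + B' i j))"
    by (simp_all add: fun_eq_iff emf_def midpoint_grid_def)
  note ct = assms[unfolded ct_step_def Let_def, folded mid emf, rule_format, of i j]
  show "B' i j = B i j - \<Delta>t *\<^sub>R curl (emf Q B Q' B') i j"
    using ct by (simp add: vec_eq_iff forall_3 curl_def algebra_simps)
  show "dens (Q i j) *\<^sub>R velocity (Q' i j) = dens (Q i j) *\<^sub>R velocity (Q i j)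
          - \<Delta>t *\<^sub>R cross3 (midpoint_grid B B' i j) (curl (midpoint_grid B B') i j)"
    and "dens (Q' i j) = dens (Q i j)"
    and "mom (Q' i j) = dens (Q i j) *\<^sub>R velocity (Q' i j)"
    and "ener (Q' i j) = ener (Q i j) - dens (Q i j) * (norm (velocity (Q i j)))\<^sup>2 / 2
          + dens (Q i j) * (norm (velocity (Q' i j)))\<^sup>2 / 2"
    using ct by (simp_all add: mid)
qed

text \<open>The work of the Lorentz force against the midpoint velocity gives the first inner
  product, and Faraday's law tested with the midpoint field gives the second.\<close>

lemma ct_step_energy_local:
  assumes "ct_step Q B Q' B'"
  shows "ener (Q' i j) + (norm (B' i j))\<^sup>2 / 2 = ener (Q i j) + (norm (B i j))\<^sup>2 / 2
    + \<Delta>t * (emf Q B Q' B' i j \<bullet> curl (midpoint_grid B B') i j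
           - midpoint_grid B B' i j \<bullet> curl (emf Q B Q' B') i j)"
proof -
  let ?v = "velocity (Q i j)" and ?v' = "velocity (Q' i j)" and ?r = "dens (Q i j)"
  let ?J = "curl (midpoint_grid B B') i j"
  define b where "b = midpoint_grid B B' i j"
  define u where "u = (1/2) *\<^sub>R (?v + ?v')"
  \<comment> \<open>Averaging old and new values makes this identity exact, so the time
    discretization adds no error to the energy.\<close>
  have polar: "((norm x')\<^sup>2 - (norm x)\<^sup>2) / 2 = (x' - x) \<bullet> ((1/2) *\<^sub>R (x + x'))" for x x' :: vec3
    by (simp add: power2_norm_eq_inner inner_simps inner_commute)
  have "ener (Q' i j) - ener (Q i j) = ?r * (((norm ?v')\<^sup>2 - (norm ?v)\<^sup>2) / 2)"
    by (simp add: ct_stepD(5)[OF assms, of i j] algebra_simps diff_divide_distrib)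
  also have "\<dots> = (?r *\<^sub>R ?v' - ?r *\<^sub>R ?v) \<bullet> u"
    by (simp only: polar u_def) (simp add: inner_simps algebra_simps)
  also have "?r *\<^sub>R ?v' - ?r *\<^sub>R ?v = - (\<Delta>t *\<^sub>R cross3 b ?J)"
    by (simp add: ct_stepD(2)[OF assms] b_def)
  \<comment> \<open>Cyclic invariance and antisymmetry of the triple product.\<close>
  also have "- (\<Delta>t *\<^sub>R cross3 b ?J) \<bullet> u = \<Delta>t * (cross3 b u \<bullet> ?J)"
    by (simp add: cross3_def inner_vec_def sum_3 algebra_simps)
  also have "cross3 b u = emf Q B Q' B' i j"
    by (simp add: b_def u_def emf_def midpoint_grid_def)
  finally have kin: "ener (Q' i j) - ener (Q i j) = \<Delta>t * (emf Q B Q' B' i j \<bullet> ?J)" .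
  have "((norm (B' i j))\<^sup>2 - (norm (B i j))\<^sup>2) / 2 = (B' i j - B i j) \<bullet> b"
    by (simp only: polar b_def midpoint_grid_def)
  also have "B' i j - B i j = - (\<Delta>t *\<^sub>R curl (emf Q B Q' B') i j)"
    by (subst ct_stepD(1)[OF assms]) simp
  finally have "((norm (B' i j))\<^sup>2 - (norm (B i j))\<^sup>2) / 2 = - \<Delta>t * (b \<bullet> curl (emf Q B Q' B') i j)"
    by (simp add: inner_commute)
  then show ?thesis
    using kin unfolding b_def by (simp add: diff_divide_distrib right_diff_distrib)
qed

lemma seam_midpoint_grid:
  "seam a b c d r F \<Longrightarrow> seam a b c d r F' \<Longrightarrow> seam a b c d r (midpoint_grid F F')"
  by (simp add: seam_def midpoint_grid_def)

text \<open>The implicit system couples distant cells, so \<open>Q'\<close> is not followed by a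
  stencil from \<open>Q\<close> and \<open>B\<close> alone. Given that \<open>B'\<close> also
  matches, the momentum equation is explicit in \<open>Q\<close> and the midpoint field, and its
  curl costs one cell.\<close>

lemma seam_ct_step:
  assumes "ct_step Q B Q' B'"
    and "seam a b c d (r + 1) Q" "seam a b c d (r + 1) B" "seam a b c d (r + 1) B'"
  shows "seam a b c d r Q'"
proof (rule seam_local[of a b c d r 1])
  let ?M = "midpoint_grid B B'"
  \<comment> \<open>Pairing the two grids lets a single stencil read both.\<close>
  show "seam a b c d (r + 1) (\<lambda>i j. (Q i j, ?M i j))"
    by (rule seam_map2[OF assms(2) seam_midpoint_grid[OF assms(3,4)], where h = Pair])
next
  let ?M = "midpoint_grid B B'"
  fix i j i' j' :: int
  assume near: "\<And>s t. \<bar>s\<bar> \<le> 1 \<Longrightarrow> \<bar>t\<bar> \<le> 1 \<Longrightarrow>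
    (Q (i + s) (j + t), ?M (i + s) (j + t)) = (Q (i' + s) (j' + t), ?M (i' + s) (j' + t))"
  have Q: "Q i j = Q i' j'" and M: "?M i j = ?M i' j'"
    using near[of 0 0] by simp_all
  have "curl ?M i j = curl ?M i' j'"
    using near[of 1 0] near[of "-1" 0] near[of 0 1] near[of 0 "-1"]
    by (simp add: curl_def Dx_def Dy_def comp_def)
  \<comment> \<open>The new velocity is eliminated, which leaves only old fluid data and the
    midpoint field on the right. Velocity and energy are recovered afterwards from momentum and
    density.\<close>
  moreover have "mom (Q' k l) = dens (Q k l) *\<^sub>R velocity (Q k l)
      - \<Delta>t *\<^sub>R cross3 (?M k l) (curl ?M k l)" for k l
    by (simp only: ct_stepD(2,4)[OF assms(1)])
  ultimately have mom: "mom (Q' i j) = mom (Q' i' j')"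
    by (simp only: Q M)
  have dens: "dens (Q' i j) = dens (Q' i' j')"
    by (simp add: ct_stepD(3)[OF assms(1)] Q)
  have "velocity (Q' i j) = velocity (Q' i' j')"
    by (simp add: velocity_def mom dens)
  then have "ener (Q' i j) = ener (Q' i' j')"
    by (simp add: ct_stepD(5)[OF assms(1)] Q)
  with mom dens show "Q' i j = Q' i' j'"
    by (simp add: mom_def dens_def ener_def prod_eq_iff)
qed

lemma ct_step_energy:
  assumes "ct_step Q B Q' B'" "a \<le> b" "c \<le> d"
    and "seam a b c d 1 Q" "seam a b c d 1 B" "seam a b c d 1 Q'" "seam a b c d 1 B'"
  shows "(\<Sum>i\<in>{a<..b}. \<Sum>j\<in>{c<..d}. ener (Q' i j) + (norm (B' i j))\<^sup>2 / 2)
       = (\<Sum>i\<in>{a<..b}. \<Sum>j\<in>{c<..d}. ener (Q i j) + (norm (B i j))\<^sup>2 / 2)"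
proof -
  have "seam a b c d 1 (midpoint_grid B B')"
    using assms by (intro seam_midpoint_grid)
  moreover have "seam a b c d 1 (emf Q B Q' B')"
    using assms by (simp add: seam_def emf_def midpoint_grid_def)
  ultimately have zero: "(\<Sum>i\<in>{a<..b}. \<Sum>j\<in>{c<..d}.
      emf Q B Q' B' i j \<bullet> curl (midpoint_grid B B') i j
      - midpoint_grid B B' i j \<bullet> curl (emf Q B Q' B') i j) = 0"
    by (intro curl_self_adjoint assms)
  show ?thesis
    by (simp only: ct_step_energy_local[OF assms(1)] sum.distrib sum_distrib_left[symmetric] zero
        mult_zero_right add_0_right)
qed

section \<open>Energy balance of the full step\<close>

text \<open>The margin is 9 = 4 + 1 + 4: the first finite volume step leaves 5, the transport step
  leaves 4, and the last finite volume step uses these for its balance. The finite volume steps keep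
  the magnetic field fixed, so conserving \<open>ener\<close> suffices there.\<close>

lemma ppct_step_energy:
  assumes "ppct_step Q B Q' B'" "a \<le> b" "c \<le> d"
    and "seam a b c d 9 Q" "seam a b c d 9 B" "seam a b c d 9 B'"
  shows "(\<Sum>i\<in>{a<..b}. \<Sum>j\<in>{c<..d}. ener (Q i j) + (norm (B i j))\<^sup>2 / 2)
       = (\<Sum>i\<in>{a<..b}. \<Sum>j\<in>{c<..d}. ener (Q' i j) + (norm (B' i j))\<^sup>2 / 2)"
proof -
  obtain Q\<^sub>1 Q\<^sub>2 where steps: "fv_step (\<Delta>t / 2) Q Q\<^sub>1" "ct_step Q\<^sub>1 B Q\<^sub>2 B'" "fv_step (\<Delta>t / 2) Q\<^sub>2 Q'"
    using assms(1) by (auto simp: ppct_step_def)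
  have Q\<^sub>1: "seam a b c d 5 Q\<^sub>1"
    by (rule seam_fv_step[OF steps(1)]) (simp add: assms)
  have Q\<^sub>2: "seam a b c d 4 Q\<^sub>2"
    by (rule seam_ct_step[OF steps(2)]) (auto intro: seam_mono Q\<^sub>1 assms)
  have Q: "seam a b c d 4 Q"
    using assms(4) by (rule seam_mono) simp
  have "(\<Sum>i\<in>{a<..b}. \<Sum>j\<in>{c<..d}. ener (Q\<^sub>2 i j) + (norm (B' i j))\<^sup>2 / 2)
      = (\<Sum>i\<in>{a<..b}. \<Sum>j\<in>{c<..d}. ener (Q\<^sub>1 i j) + (norm (B i j))\<^sup>2 / 2)"
    by (rule ct_step_energy[OF steps(2) assms(2,3)])
      (rule seam_mono, rule Q\<^sub>1 Q\<^sub>2 assms, simp)+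
  then show ?thesis
    using fv_step_energy[OF steps(1) assms(2,3) Q] fv_step_energy[OF steps(3) assms(2,3) Q\<^sub>2]
    by (simp add: sum.distrib)
qed

end

section \<open>Periodic and compactly supported data\<close>

theorem corollary3p15:
  fixes \<Delta>x \<Delta>y \<Delta>t \<gamma> \<epsilon> q :: real
    and Nx Ny :: int
    and Qn Qn1 :: "state grid"
    and Bn Bn1 :: "vec3 grid"
  assumes "ppct \<Delta>x \<Delta>y \<Delta>t \<gamma> \<epsilon> q"
    and "Nx > 0" and "Ny > 0"
    and "ppct.ppct_step \<Delta>x \<Delta>y \<Delta>t \<gamma> \<epsilon> q Qn Bn Qn1 Bn1"
    and "(periodic Nx Ny Qn \<and> periodic Nx Ny Bn \<and> periodic Nx Ny Qn1 \<and> periodic Nx Ny Bn1)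
       \<or> supported_in Nx Ny Qn Bn Qn1 Bn1"
  shows "(\<Sum>i=1..Nx. \<Sum>j=1..Ny. ener (Qn i j) + (norm (Bn i j))\<^sup>2 / 2)
       = (\<Sum>i=1..Nx. \<Sum>j=1..Ny. ener (Qn1 i j) + (norm (Bn1 i j))\<^sup>2 / 2)"
proof -
  interpret ppct \<Delta>x \<Delta>y \<Delta>t \<gamma> \<epsilon> q by fact
  have mesh: "{1..n} = {0<..n}" for n :: int by auto
  from assms(5) show ?thesis
  proof
    assume "periodic Nx Ny Qn \<and> periodic Nx Ny Bn \<and> periodic Nx Ny Qn1 \<and> periodic Nx Ny Bn1"
    then show ?thesis
      \<comment> \<open>The grids extend over all integers, so margin 9 is available even on a mesh
        with fewer than 9 cells per direction.\<close>
      unfolding mesh using assms(2-4) by (intro ppct_step_energy seam_periodic) auto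
  next
    assume "supported_in Nx Ny Qn Bn Qn1 Bn1"
    then obtain Q\<^sub>0 where out: "\<And>i j. (i, j) \<notin> {1..Nx} \<times> {1..Ny} \<Longrightarrow>
        Qn i j = Q\<^sub>0 \<and> Qn1 i j = Q\<^sub>0 \<and> Bn i j = 0 \<and> Bn1 i j = 0"
      unfolding supported_in_def by blast
    \<comment> \<open>The corners are those of \<open>seam_supported\<close> with
      \<open>r = 9\<close>.\<close>
    have "seam (-9) (Nx + 9 + 1) (-9) (Ny + 9 + 1) 9 Qn"
         "seam (-9) (Nx + 9 + 1) (-9) (Ny + 9 + 1) 9 Bn"
         "seam (-9) (Nx + 9 + 1) (-9) (Ny + 9 + 1) 9 Bn1"
      using out by (blast intro: seam_supported)+
    then have "(\<Sum>i\<in>{-9<..Nx + 9 + 1}. \<Sum>j\<in>{-9<..Ny + 9 + 1}. ener (Qn i j) + (norm (Bn i j))\<^sup>2 / 2)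
        = (\<Sum>i\<in>{-9<..Nx + 9 + 1}. \<Sum>j\<in>{-9<..Ny + 9 + 1}. ener (Qn1 i j) + (norm (Bn1 i j))\<^sup>2 / 2)"
      using assms(2-4) by (intro ppct_step_energy) auto
    then show ?thesis
    \<comment> \<open>Both time levels share the same ambient state outside the mesh, so the extra
      cells contribute equally.\<close>
    proof (rule sum_box_eq_imp_subbox_eq)
      fix i j assume "(i, j) \<notin> {1..Nx} \<times> {1..Ny}"
      from out[OF this] show "ener (Qn i j) + (norm (Bn i j))\<^sup>2 / 2
          = ener (Qn1 i j) + (norm (Bn1 i j))\<^sup>2 / 2"
        by simp
    qed auto
  qed
qed

end
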